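(* Let $G$ be a graph and let $d$ be a positive integer such that $d$ divides $d_G(v)$ for every $v\in V(G)$ and $d$ does not divide $|E(G)|$. Then for every positive integer $k$, $G$ has no cyclic interval $dk$-coloring.
   Context: All graphs are finite and undirected; multiple edges are allowed, loops are not. A proper $t$-edge coloring of $G$ is a map $\alpha:E(G)\to\{1,\dots,t\}$ with $\alpha(e)\neq\alpha(e')$ for adjacent edges $e,e'$; $S(v,\alpha)$ is the set of colors on edges incident to $v$. A proper $t$-edge coloring $\alpha$ is a cyclic interval $t$-coloring if for every vertex $v$, either $S(v,\alpha)$ or $\{1,\dots,t\}\setminus S(v,\alpha)$ is a set of consecutive integers. *)

theory Defs
  imports Main "HOL-Library.FuncSet"
begin

text \<open>
  Undirected graphs with multiple edges: edges are named objects, and \<open>mg_ends\<close> maps an edge to its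
  set of endpoints. Requiring this set to have exactly two elements excludes loops.
\<close>

record ('v, 'e) multigraph =
  mg_verts :: "'v set"
  mg_edges :: "'e set"
  mg_ends :: "'e \<Rightarrow> 'v set"

locale finite_multigraph =
  fixes G :: "('v, 'e) multigraph" (structure)
  assumes finite_verts: "finite (mg_verts G)"
    and finite_edges: "finite (mg_edges G)"
    and ends_in_verts: "e \<in> mg_edges G \<Longrightarrow> mg_ends G e \<subseteq> mg_verts G"
    and two_ends: "e \<in> mg_edges G \<Longrightarrow> card (mg_ends G e) = 2"

definition incident_edges :: "('v, 'e) multigraph \<Rightarrow> 'v \<Rightarrow> 'e set" where
  "incident_edges G v = {e \<in> mg_edges G. v \<in> mg_ends G e}"

text \<open>There are no loops, so each incident edge contributes one to the degree.\<close>

definition degree :: "('v, 'e) multigraph \<Rightarrow> 'v \<Rightarrow> nat" where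
  "degree G v = card (incident_edges G v)"

text \<open>Parallel edges are adjacent.\<close>

definition adjacent_edges :: "('v, 'e) multigraph \<Rightarrow> 'e \<Rightarrow> 'e \<Rightarrow> bool" where
  "adjacent_edges G e e' \<longleftrightarrow>
     e \<in> mg_edges G \<and> e' \<in> mg_edges G \<and> e \<noteq> e' \<and> mg_ends G e \<inter> mg_ends G e' \<noteq> {}"

definition proper_edge_coloring :: "('v, 'e) multigraph \<Rightarrow> nat \<Rightarrow> ('e \<Rightarrow> nat) \<Rightarrow> bool" where
  "proper_edge_coloring G t \<alpha> \<longleftrightarrow>
     \<alpha> \<in> mg_edges G \<rightarrow> {1..t} \<and> (\<forall>e e'. adjacent_edges G e e' \<longrightarrow> \<alpha> e \<noteq> \<alpha> e')"

definition spectrum :: "('v, 'e) multigraph \<Rightarrow> ('e \<Rightarrow> nat) \<Rightarrow> 'v \<Rightarrow> nat set" where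
  "spectrum G \<alpha> v = \<alpha> ` incident_edges G v"

text \<open>
  The empty set counts as consecutive. This is immaterial for cyclic interval colorings: if one of
  a spectrum and its complement is empty, then the other is all of \<open>{1..t}\<close>.
\<close>

definition consecutive :: "nat set \<Rightarrow> bool" where
  "consecutive S \<longleftrightarrow> (\<exists>a b. S = {a..b})"

definition cyclic_interval_coloring :: "('v, 'e) multigraph \<Rightarrow> nat \<Rightarrow> ('e \<Rightarrow> nat) \<Rightarrow> bool" where
  "cyclic_interval_coloring G t \<alpha> \<longleftrightarrow>
     proper_edge_coloring G t \<alpha> \<and>
     (\<forall>v \<in> mg_verts G.
        consecutive (spectrum G \<alpha> v) \<or> consecutive ({1..t} - spectrum G \<alpha> v))"

end

theory Submission
  imports Defs
begin

text \<open>
  A consecutive set of colors whose size is a multiple of \<open>d\<close> consists of full blocks of residues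
  modulo \<open>d\<close>, so exactly one \<open>d\<close>-th of it is divisible by \<open>d\<close>; as \<open>d\<close> divides \<open>d * k\<close>, the same
  holds for complements in \<open>{1..d * k}\<close>. Hence at every vertex exactly one \<open>d\<close>-th of the incident
  edges has a color divisible by \<open>d\<close>. Summing over the vertices counts each edge twice, so the
  number of edges is \<open>d\<close> times the number of edges with such a color.
\<close>

text \<open>The elements of a window of length \<open>d\<close> are pairwise incongruent modulo
  \<open>d\<close>, since their differences lie strictly between 0 and \<open>d\<close>. By
  counting, all \<open>d\<close> residues occur, so residue 0 is hit exactly once.\<close>

lemma card_multiples_block:
  fixes a d :: nat
  assumes "d > 0"
  shows "card {x \<in> {a..<a + d}. d dvd x} = 1"
proof -
  have inj: "inj_on (\<lambda>x. x mod d) {a..<a + d}"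
  proof (rule linorder_inj_onI')
    fix x y assume "x \<in> {a..<a + d}" "y \<in> {a..<a + d}" "x < y"
    then have "0 < y - x" "y - x < d" by auto
    then show "x mod d \<noteq> y mod d"
      using mod_eq_dvd_iff_nat[of x y d] \<open>x < y\<close> by (metis less_imp_le_nat nat_dvd_not_less)
  qed
  then have "(\<lambda>x. x mod d) ` {a..<a + d} = {..<d}"
    using assms by (intro card_subset_eq) (auto simp: card_image)
  then obtain x where x: "x \<in> {a..<a + d}" "x mod d = 0"
    using assms by (metis imageE lessThan_iff)
  then have "{y \<in> {a..<a + d}. d dvd y} = {x}"
    using inj_onD[OF inj, of _ x] by fastforce
  then show ?thesis by simp
qed

lemma card_multiples_blocks:
  fixes a d m :: nat
  assumes "d > 0"
  shows "card {x \<in> {a..<a + d * m}. d dvd x} = m"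
proof (induction m)
  case (Suc m)
  have "{x \<in> {a..<a + d * Suc m}. d dvd x} =
      {x \<in> {a..<a + d * m}. d dvd x} \<union> {x \<in> {a + d * m..<a + d * m + d}. d dvd x}"
    by auto
  then show ?case
    using Suc card_multiples_block[OF assms, of "a + d * m"]
    by (simp add: card_Un_disjoint disjoint_iff)
qed simp

lemma card_multiples_consecutive:
  assumes "consecutive S" "d dvd card S" "d > 0"
  shows "d * card {x \<in> S. d dvd x} = card S"
proof -
  obtain a b where S: "S = {a..b}"
    using assms(1) unfolding consecutive_def by blast
  obtain m where m: "card S = d * m"
    using assms(2) by blast
  show ?thesis
  proof (cases "a \<le> b")
    case True
    \<comment> \<open>Counting gives \<open>Suc b - a = d * m\<close>; with \<open>a \<le> b\<close>
      this means \<open>Suc b = a + d * m\<close>. In the other case \<open>S\<close> is empty and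
      both sides are 0.\<close>
    then have "S = {a..<a + d * m}"
      using S m by auto
    then show ?thesis
      using m card_multiples_blocks[OF assms(3)] by simp
  qed (simp add: S)
qed

text \<open>The identity holds for the complement and for all of \<open>{1..d * k}\<close>, both
  consecutive and of size divisible by \<open>d\<close>; subtracting gives it for
  \<open>S\<close>.\<close>

lemma card_multiples_consecutive_compl:
  assumes "consecutive ({1..d * k} - S)" "S \<subseteq> {1..d * k}" "d dvd card S" "d > 0"
  shows "d * card {x \<in> S. d dvd x} = card S"
proof -
  let ?U = "{1..d * k}" and ?M = "\<lambda>A. {x \<in> A. d dvd x}"
  have fin: "finite S"
    using assms(2) finite_subset by blast
  have card_U: "card ?U = card S + card (?U - S)"
    using card_Un_disjoint[OF fin, of "?U - S"] assms(2) by (simp add: Un_absorb1)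
  \<comment> \<open>The left side of \<open>card_U\<close> is
    \<open>Suc (d * k) - 1 = d * k\<close>.\<close>
  then have "d dvd card S + card (?U - S)"
    by (metis card_atLeastAtMost diff_Suc_1 dvd_triv_left)
  then have "d dvd card (?U - S)"
    using assms(3) by (simp only: dvd_add_right_iff)
  then have compl: "d * card (?M (?U - S)) = card (?U - S)"
    using assms(1,4) card_multiples_consecutive by blast
  have U: "d * card (?M ?U) = card ?U"
    using assms(4) by (intro card_multiples_consecutive) (auto simp: consecutive_def)
  have "?M ?U = ?M S \<union> ?M (?U - S)"
    using assms(2) by auto
  moreover have "card (?M S \<union> ?M (?U - S)) = card (?M S) + card (?M (?U - S))"
    using fin by (intro card_Un_disjoint) auto
  ultimately show ?thesis
    using compl U card_U by (simp add: distrib_left)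
qed

text \<open>Double counting of incident pairs: every edge has exactly two ends among the vertices.
  With \<open>P\<close> constantly true this is the handshake identity; the other use selects the
  edges whose color is divisible by \<open>d\<close>.\<close>

lemma (in finite_multigraph) sum_card_incident:
  "(\<Sum>v\<in>mg_verts G. card {e \<in> incident_edges G v. P e}) = 2 * card {e \<in> mg_edges G. P e}"
proof -
  have "(\<Sum>v\<in>mg_verts G. card {e \<in> {e \<in> mg_edges G. P e}. v \<in> mg_ends G e})
      = 2 * card {e \<in> mg_edges G. P e}"
  proof (rule sum_multicount)
    show "\<forall>e \<in> {e \<in> mg_edges G. P e}. card {v \<in> mg_verts G. v \<in> mg_ends G e} = 2"
    proof
      fix e assume "e \<in> {e \<in> mg_edges G. P e}"
      then have e: "e \<in> mg_edges G" by simp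
      then have "{v \<in> mg_verts G. v \<in> mg_ends G e} = mg_ends G e"
        using ends_in_verts by blast
      then show "card {v \<in> mg_verts G. v \<in> mg_ends G e} = 2"
        using two_ends[OF e] by simp
    qed
  qed (simp_all add: finite_verts finite_edges)
  moreover have "{e \<in> {e \<in> mg_edges G. P e}. v \<in> mg_ends G e} = {e \<in> incident_edges G v. P e}" for v
    by (auto simp: incident_edges_def)
  ultimately show ?thesis by simp
qed

lemma inj_on_incident_edges:
  assumes "proper_edge_coloring G t \<alpha>"
  shows "inj_on \<alpha> (incident_edges G v)"
proof (rule inj_onI, rule ccontr)
  fix e e' assume e: "e \<in> incident_edges G v" "e' \<in> incident_edges G v" "\<alpha> e = \<alpha> e'" "e \<noteq> e'"
  then have "adjacent_edges G e e'"
    unfolding incident_edges_def adjacent_edges_def by blast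
  then show False
    using assms e(3) unfolding proper_edge_coloring_def by blast
qed

text \<open>A proper coloring is injective on the edges at \<open>v\<close>, so the counts of colors
  in the spectrum transfer to counts of incident edges.\<close>

lemma card_incident_multiples:
  assumes "cyclic_interval_coloring G (d * k) \<alpha>" "v \<in> mg_verts G" "d dvd degree G v" "d > 0"
  shows "d * card {e \<in> incident_edges G v. d dvd \<alpha> e} = degree G v"
proof -
  let ?S = "spectrum G \<alpha> v"
  have proper: "proper_edge_coloring G (d * k) \<alpha>"
    using assms(1) by (simp add: cyclic_interval_coloring_def)
  note inj = inj_on_incident_edges[OF proper, of v]
  have card_S: "card ?S = degree G v"
    using inj by (simp add: spectrum_def degree_def card_image)
  have "?S \<subseteq> {1..d * k}"
    using proper by (auto simp: spectrum_def incident_edges_def proper_edge_coloring_def)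
  moreover have "consecutive ?S \<or> consecutive ({1..d * k} - ?S)"
    using assms(1,2) by (simp add: cyclic_interval_coloring_def)
  ultimately have "d * card {x \<in> ?S. d dvd x} = card ?S"
    using assms(3,4) card_S card_multiples_consecutive card_multiples_consecutive_compl by metis
  moreover have "{x \<in> ?S. d dvd x} = \<alpha> ` {e \<in> incident_edges G v. d dvd \<alpha> e}"
    by (auto simp: spectrum_def)
  moreover have "inj_on \<alpha> {e \<in> incident_edges G v. d dvd \<alpha> e}"
    using inj by (rule inj_on_subset) auto
  ultimately show ?thesis
    using card_S by (simp add: card_image)
qed

theorem theorem7:
  fixes G :: "('v, 'e) multigraph" and d :: nat
  assumes "finite_multigraph G"
    and "d > 0"
    and "\<forall>v \<in> mg_verts G. d dvd degree G v"
    and "\<not> d dvd card (mg_edges G)"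
  shows "\<forall>k::nat. k > 0 \<longrightarrow> \<not> (\<exists>\<alpha>. cyclic_interval_coloring G (d * k) \<alpha>)"
proof (intro allI impI notI)
  fix k :: nat
  assume "\<exists>\<alpha>. cyclic_interval_coloring G (d * k) \<alpha>"
  then obtain \<alpha> where \<alpha>: "cyclic_interval_coloring G (d * k) \<alpha>" ..
  let ?E = "{e \<in> mg_edges G. d dvd \<alpha> e}"
  note sum_card = finite_multigraph.sum_card_incident[OF assms(1)]
  have "2 * card (mg_edges G) = (\<Sum>v\<in>mg_verts G. degree G v)"
    using sum_card[of "\<lambda>_. True"] by (simp add: degree_def)
  also have "\<dots> = (\<Sum>v\<in>mg_verts G. d * card {e \<in> incident_edges G v. d dvd \<alpha> e})"
    using card_incident_multiples[OF \<alpha>] assms(2,3) by simp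
  also have "\<dots> = d * (2 * card ?E)"
    using sum_card[of "\<lambda>e. d dvd \<alpha> e"] by (simp add: sum_distrib_left[symmetric])
  \<comment> \<open>Both sides carry the factor 2 from double counting; cancelling it gives
    divisibility by \<open>d\<close> itself, also for even \<open>d\<close>.\<close>
  finally have "card (mg_edges G) = d * card ?E" by simp
  then show False using assms(4) by simp
qed

end
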